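(* Let $R$ be an associative ring with identity and let $n\ge 1$. Let $(B\,|\,A)\in L'_n(R)$, where $B$ is an $m\times k$ matrix. Then: (1) if $U$ is a matrix over $R$ with $m$ columns, then $(B\,|\,A)\le_n (UB\,|\,UA)$; (2) if $V$ is a matrix over $R$ with $k$ rows, then $(BV\,|\,A)\le_n (B\,|\,A)$; (3) if $G$ is a $k\times n$ matrix over $R$, then $(B\,|\,A+BG)\le_n (B\,|\,A)$. Moreover, the relation $\le_n$ is the least pre-order on $L'_n(R)$ satisfying (1), (2) and (3) (for all $(B\,|\,A)\in L'_n(R)$ and all such $U$, $V$, $G$).
   Context: $R$ is an associative, not necessarily commutative, ring with identity. For $n\ge 1$, $L'_n(R)$ is the collection of pairs $(B\,|\,A)$ of matrices with entries in $R$ such that $A$ has $n$ columns and $B$ has the same number of rows as $A$ (the number of rows, and the number of columns of $B$, are arbitrary). The relation $(B\,|\,A)\le_n (B'\,|\,A')$ holds in $L'_n(R)$ if there exist matrices $U,V,G$ over $R$, of appropriate size, such that $UB=B'V$ and $UA=A'+B'G$. A pre-order is a reflexive and transitive relation; "least" means contained, as a relation, in every other such pre-order. *)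

theory Defs
  imports "Jordan_Normal_Form.Matrix"
begin

text \<open>
  The coefficient sort \<open>{ring, monoid_mult}\<close> is that of associative rings with identity; unlike
  \<open>ring_1\<close> it does not exclude the zero ring. A pair \<open>(B | A)\<close> is the tuple \<open>(B, A)\<close>, and
  matrices without rows or without columns are allowed.
\<close>

definition matrix_pairs :: "nat \<Rightarrow> ('a mat \<times> 'a mat) set" where
  "matrix_pairs n = {(B, A). dim_row B = dim_row A \<and> dim_col A = n}"

text \<open>
  Multiplication and addition of type \<^typ>\<open>'a mat\<close> are total, so the sizes for which
  \<open>U B = B' V\<close> and \<open>U A = A' + B' G\<close> make sense have to be required explicitly.
\<close>

definition pair_le :: "nat \<Rightarrow> ('a :: {ring, monoid_mult} mat \<times> 'a mat) rel" where
  "pair_le n = {((B, A), (B', A')).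
     (B, A) \<in> matrix_pairs n \<and> (B', A') \<in> matrix_pairs n \<and>
     (\<exists>U V G. U \<in> carrier_mat (dim_row B') (dim_row B) \<and>
              V \<in> carrier_mat (dim_col B') (dim_col B) \<and>
              G \<in> carrier_mat (dim_col B') n \<and>
              U * B = B' * V \<and> U * A = A' + B' * G)}"

definition left_mult_increasing ::
    "nat \<Rightarrow> ('a :: {ring, monoid_mult} mat \<times> 'a mat) rel \<Rightarrow> bool" where
  "left_mult_increasing n r \<longleftrightarrow>
     (\<forall>B A U. (B, A) \<in> matrix_pairs n \<longrightarrow> dim_col U = dim_row B \<longrightarrow>
        ((B, A), (U * B, U * A)) \<in> r)"

definition right_mult_decreasing ::
    "nat \<Rightarrow> ('a :: {ring, monoid_mult} mat \<times> 'a mat) rel \<Rightarrow> bool" where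
  "right_mult_decreasing n r \<longleftrightarrow>
     (\<forall>B A V. (B, A) \<in> matrix_pairs n \<longrightarrow> dim_row V = dim_col B \<longrightarrow>
        ((B * V, A), (B, A)) \<in> r)"

definition translation_decreasing ::
    "nat \<Rightarrow> ('a :: {ring, monoid_mult} mat \<times> 'a mat) rel \<Rightarrow> bool" where
  "translation_decreasing n r \<longleftrightarrow>
     (\<forall>B A G. (B, A) \<in> matrix_pairs n \<longrightarrow> G \<in> carrier_mat (dim_col B) n \<longrightarrow>
        ((B, A + B * G), (B, A)) \<in> r)"

definition compatible_preorder ::
    "nat \<Rightarrow> ('a :: {ring, monoid_mult} mat \<times> 'a mat) rel \<Rightarrow> bool" where
  "compatible_preorder n r \<longleftrightarrow>
     preorder_on (matrix_pairs n) r \<and> left_mult_increasing n r \<and>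
     right_mult_decreasing n r \<and> translation_decreasing n r"

end

theory Submission
  imports Defs
begin

text \<open>
  Each of the three closure properties is a special case of the defining equations
  \<open>U B = B' V\<close> and \<open>U A = A' + B' G\<close>: those of \<open>U\<close> and \<open>V\<close> that do not occur in the
  property are taken to be identity matrices, and \<open>G\<close> to be zero if it does not occur.
  Reflexivity is multiplication on the left by the identity. Transitivity holds because the
  witnesses compose: if \<open>(U, V, G)\<close> relates \<open>(B | A)\<close> to \<open>(B' | A')\<close> and \<open>(U', V', G')\<close> relates
  \<open>(B' | A')\<close> to \<open>(B'' | A'')\<close>, then \<open>(U' U, V' V, G' + V' G)\<close> relates \<open>(B | A)\<close> to
  \<open>(B'' | A'')\<close>.

  For leastness, the two equations say that the pairs \<open>(U B | U A)\<close> and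
  \<open>(B' V | A' + B' G)\<close> are equal. Hence every instance of the relation splits into one step of
  each kind,
  \<open>(B | A) \<le> (U B | U A) = (B' V | A' + B' G) \<le> (B' | A' + B' G) \<le> (B' | A')\<close>,
  and so lies in any pre-order that contains these steps.
\<close>

text \<open>
  The zero ring is of sort \<open>{ring, monoid_mult}\<close>, so the neutrality of the identity matrix
  cannot be taken from \<^class>\<open>semiring_1\<close>, where \<open>0 \<noteq> 1\<close>.
\<close>

lemma one_mat_mult_left:
  fixes M :: "'a :: {ring, monoid_mult} mat"
  assumes "dim_row M = m"
  shows "1\<^sub>m m * M = M"
proof (rule eq_matI)
  fix i j assume "i < dim_row M" "j < dim_col M"
  then have ij: "i < m" "j < dim_col M" using assms by auto
  then have "(1\<^sub>m m * M) $$ (i, j) = (\<Sum>l = 0..<m. (if i = l then 1 else 0) * M $$ (l, j))"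
    using assms by (auto simp: scalar_prod_def intro!: sum.cong)
  also have "\<dots> = (\<Sum>l = 0..<m. if i = l then M $$ (l, j) else 0)"
    by (intro sum.cong) auto
  also have "\<dots> = M $$ (i, j)" using ij by simp
  finally show "(1\<^sub>m m * M) $$ (i, j) = M $$ (i, j)" .
qed (use assms in auto)

lemma one_mat_mult_right:
  fixes M :: "'a :: {ring, monoid_mult} mat"
  assumes "dim_col M = k"
  shows "M * 1\<^sub>m k = M"
proof (rule eq_matI)
  fix i j assume "i < dim_row M" "j < dim_col M"
  then have ij: "i < dim_row M" "j < k" using assms by auto
  then have "(M * 1\<^sub>m k) $$ (i, j) = (\<Sum>l = 0..<k. M $$ (i, l) * (if l = j then 1 else 0))"
    using assms by (auto simp: scalar_prod_def intro!: sum.cong)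
  also have "\<dots> = (\<Sum>l = 0..<k. if l = j then M $$ (i, l) else 0)"
    by (intro sum.cong) auto
  also have "\<dots> = M $$ (i, j)" using ij by simp
  finally show "(M * 1\<^sub>m k) $$ (i, j) = M $$ (i, j)" .
qed (use assms in auto)

lemma pair_leI:
  fixes A B A' B' U V G :: "'a :: {ring, monoid_mult} mat"
  assumes "B \<in> carrier_mat m k" "A \<in> carrier_mat m n"
    and "B' \<in> carrier_mat m' k'" "A' \<in> carrier_mat m' n"
    and "U \<in> carrier_mat m' m" "V \<in> carrier_mat k' k" "G \<in> carrier_mat k' n"
    and "U * B = B' * V" "U * A = A' + B' * G"
  shows "((B, A), (B', A')) \<in> pair_le n"
proof -
  have "(B, A) \<in> matrix_pairs n" "(B', A') \<in> matrix_pairs n"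
    using assms(1-4) unfolding matrix_pairs_def by auto
  moreover have "U \<in> carrier_mat (dim_row B') (dim_row B)"
    "V \<in> carrier_mat (dim_col B') (dim_col B)" "G \<in> carrier_mat (dim_col B') n"
    using assms(1-7) by auto
  ultimately show ?thesis
    using assms(8,9) unfolding pair_le_def by blast
qed

text \<open>
  The sizes of \<open>B\<close> and \<open>B'\<close> are premises here rather than obtained values, so that two
  consecutive instances of the relation speak of the same sizes for their common pair.
\<close>

lemma pair_leE:
  fixes A B A' B' :: "'a :: {ring, monoid_mult} mat"
  assumes "((B, A), (B', A')) \<in> pair_le n"
    and "B \<in> carrier_mat m k" "B' \<in> carrier_mat m' k'"
  obtains U V G where
    "A \<in> carrier_mat m n" "A' \<in> carrier_mat m' n"
    "U \<in> carrier_mat m' m" "V \<in> carrier_mat k' k" "G \<in> carrier_mat k' n"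
    "U * B = B' * V" "U * A = A' + B' * G"
proof -
  have dims: "dim_row B = m" "dim_col B = k" "dim_row B' = m'" "dim_col B' = k'"
    using assms(2,3) by auto
  from assms(1) have "A \<in> carrier_mat m n" "A' \<in> carrier_mat m' n"
    unfolding pair_le_def matrix_pairs_def using dims by auto
  moreover from assms(1) obtain U V G where
    "U \<in> carrier_mat m' m" "V \<in> carrier_mat k' k" "G \<in> carrier_mat k' n"
    "U * B = B' * V" "U * A = A' + B' * G"
    unfolding pair_le_def dims[symmetric] by blast
  ultimately show thesis by (rule that)
qed

lemma matrix_pairsE:
  assumes "(B, A) \<in> matrix_pairs n"
  obtains m k where "B \<in> carrier_mat m k" "A \<in> carrier_mat m n"
  using assms unfolding matrix_pairs_def by auto

lemma pair_le_left_mult: "left_mult_increasing n (pair_le n)"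
  unfolding left_mult_increasing_def
proof (intro allI impI)
  fix B A U :: "'a mat"
  assume "(B, A) \<in> matrix_pairs n" and "dim_col U = dim_row B"
  then obtain m k m' where c: "B \<in> carrier_mat m k" "A \<in> carrier_mat m n" "U \<in> carrier_mat m' m"
    by (metis carrier_matD(1) carrier_matI matrix_pairsE)
  then have eq: "U * B = (U * B) * 1\<^sub>m k" "U * A = U * A + (U * B) * 0\<^sub>m k n"
    by (simp_all add: one_mat_mult_right)
  show "((B, A), (U * B, U * A)) \<in> pair_le n"
    by (rule pair_leI[where k' = k, OF c(1,2) _ _ c(3) _ _ eq]) (use c in auto)
qed

lemma pair_le_right_mult: "right_mult_decreasing n (pair_le n)"
  unfolding right_mult_decreasing_def
proof (intro allI impI)
  fix B A V :: "'a mat"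
  assume "(B, A) \<in> matrix_pairs n" and "dim_row V = dim_col B"
  then obtain m k k' where c: "B \<in> carrier_mat m k" "A \<in> carrier_mat m n" "V \<in> carrier_mat k k'"
    by (metis carrier_matD(2) carrier_matI matrix_pairsE)
  then have eq: "1\<^sub>m m * (B * V) = B * V" "1\<^sub>m m * A = A + B * 0\<^sub>m k n"
    by (simp_all add: one_mat_mult_left)
  show "((B * V, A), (B, A)) \<in> pair_le n"
    by (rule pair_leI[OF _ c(2) c(1,2) _ c(3) _ eq]) (use c in auto)
qed

lemma pair_le_translation: "translation_decreasing n (pair_le n)"
  unfolding translation_decreasing_def
proof (intro allI impI)
  fix B A G :: "'a mat"
  assume "(B, A) \<in> matrix_pairs n" and "G \<in> carrier_mat (dim_col B) n"
  then obtain m k where c: "B \<in> carrier_mat m k" "A \<in> carrier_mat m n" "G \<in> carrier_mat k n"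
    by (metis carrier_matD(2) matrix_pairsE)
  then have eq: "1\<^sub>m m * B = B * 1\<^sub>m k" "1\<^sub>m m * (A + B * G) = A + B * G"
    by (simp_all add: one_mat_mult_left one_mat_mult_right)
  show "((B, A + B * G), (B, A)) \<in> pair_le n"
    by (rule pair_leI[OF c(1) _ c(1,2) _ _ c(3) eq]) (use c in auto)
qed

lemma trans_pair_le: "trans (pair_le n)"
proof (rule transI, clarify)
  fix B A B' A' B'' A'' :: "'a mat"
  assume le: "((B, A), (B', A')) \<in> pair_le n" and le': "((B', A'), (B'', A'')) \<in> pair_le n"
  obtain m k m' k' m'' k'' where b: "B \<in> carrier_mat m k" "B' \<in> carrier_mat m' k'"
    "B'' \<in> carrier_mat m'' k''"
    using carrier_matI by blast
  from le b(1,2) obtain U V G where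
    c: "A \<in> carrier_mat m n" "A' \<in> carrier_mat m' n"
      "U \<in> carrier_mat m' m" "V \<in> carrier_mat k' k" "G \<in> carrier_mat k' n"
    and eq: "U * B = B' * V" "U * A = A' + B' * G"
    by (rule pair_leE)
  from le' b(2,3) obtain U' V' G' where
    c': "A'' \<in> carrier_mat m'' n"
      "U' \<in> carrier_mat m'' m'" "V' \<in> carrier_mat k'' k'" "G' \<in> carrier_mat k'' n"
    and eq': "U' * B' = B'' * V'" "U' * A' = A'' + B'' * G'"
    by (rule pair_leE)
  have "(U' * U) * B = U' * (B' * V)"
    unfolding eq(1)[symmetric] by (rule assoc_mult_mat[OF c'(2) c(3) b(1)])
  also have "\<dots> = (B'' * V') * V"
    unfolding eq'(1)[symmetric] by (rule assoc_mult_mat[OF c'(2) b(2) c(4), symmetric])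
  also have "\<dots> = B'' * (V' * V)"
    by (rule assoc_mult_mat[OF b(3) c'(3) c(4)])
  finally have UB: "(U' * U) * B = B'' * (V' * V)" .
  have "(U' * U) * A = U' * (A' + B' * G)"
    unfolding eq(2)[symmetric] by (rule assoc_mult_mat[OF c'(2) c(3) c(1)])
  also have "\<dots> = U' * A' + U' * (B' * G)"
    using mult_carrier_mat[OF b(2) c(5)] by (rule mult_add_distrib_mat[OF c'(2) c(2)])
  also have "U' * (B' * G) = (B'' * V') * G"
    unfolding eq'(1)[symmetric] by (rule assoc_mult_mat[OF c'(2) b(2) c(5), symmetric])
  also have "\<dots> = B'' * (V' * G)"
    by (rule assoc_mult_mat[OF b(3) c'(3) c(5)])
  also have "U' * A' + B'' * (V' * G) = A'' + (B'' * G' + B'' * (V' * G))"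
    unfolding eq'(2) using b(3) c'(3,4) c(5)
    by (intro assoc_add_mat[OF c'(1)] mult_carrier_mat)
  also have "B'' * G' + B'' * (V' * G) = B'' * (G' + V' * G)"
    by (rule mult_add_distrib_mat[OF b(3) c'(4) mult_carrier_mat[OF c'(3) c(5)], symmetric])
  finally have UA: "(U' * U) * A = A'' + B'' * (G' + V' * G)" .
  show "((B, A), (B'', A'')) \<in> pair_le n"
    using c c' by (intro pair_leI[OF b(1) c(1) b(3) c'(1) _ _ _ UB UA]) auto
qed

lemma preorder_on_pair_le: "preorder_on (matrix_pairs n) (pair_le n)"
proof -
  have "((B, A), (B, A)) \<in> pair_le n" if "(B, A) \<in> matrix_pairs n" for B A :: "'a mat"
  proof -
    from that obtain m k where c: "B \<in> carrier_mat m k" "A \<in> carrier_mat m n"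
      by (rule matrix_pairsE)
    have "dim_col (1\<^sub>m m :: 'a mat) = dim_row B" using c by simp
    then have "((B, A), (1\<^sub>m m * B, 1\<^sub>m m * A)) \<in> pair_le n"
      using pair_le_left_mult[unfolded left_mult_increasing_def] that by blast
    then show ?thesis
      unfolding one_mat_mult_left[OF carrier_matD(1)[OF c(1)]]
        one_mat_mult_left[OF carrier_matD(1)[OF c(2)]] .
  qed
  moreover have "pair_le n \<subseteq> matrix_pairs n \<times> (matrix_pairs n :: ('a mat \<times> 'a mat) set)"
    unfolding pair_le_def by auto
  ultimately show ?thesis
    using trans_pair_le unfolding preorder_on_def refl_on_def by auto
qed

lemma pair_le_least:
  fixes r :: "('a :: {ring, monoid_mult} mat \<times> 'a mat) rel"
  assumes "compatible_preorder n r"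
  shows "pair_le n \<subseteq> r"
proof clarify
  fix B A B' A' :: "'a mat"
  assume "((B, A), (B', A')) \<in> pair_le n"
  moreover obtain m k m' k' where b: "B \<in> carrier_mat m k" "B' \<in> carrier_mat m' k'"
    using carrier_matI by blast
  ultimately obtain U V G where
    c: "A \<in> carrier_mat m n" "A' \<in> carrier_mat m' n"
      "U \<in> carrier_mat m' m" "V \<in> carrier_mat k' k" "G \<in> carrier_mat k' n"
    and eq: "U * B = B' * V" "U * A = A' + B' * G"
    by (rule pair_leE)
  have r: "trans r" "left_mult_increasing n r" "right_mult_decreasing n r"
    "translation_decreasing n r"
    using assms unfolding compatible_preorder_def preorder_on_def by auto
  have pairs: "(B, A) \<in> matrix_pairs n" "(B', A') \<in> matrix_pairs n"
    "(B', A' + B' * G) \<in> matrix_pairs n"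
    using b c unfolding matrix_pairs_def by auto
  have dims: "dim_col U = dim_row B" "dim_row V = dim_col B'" "G \<in> carrier_mat (dim_col B') n"
    using b c by auto
  have "((B, A), (U * B, U * A)) \<in> r"
    using r(2) pairs(1) dims(1) unfolding left_mult_increasing_def by blast
  \<comment> \<open>The defining equations identify this target with the source of a right multiplication step.\<close>
  then have "((B, A), (B' * V, A' + B' * G)) \<in> r"
    unfolding eq .
  moreover have "((B' * V, A' + B' * G), (B', A' + B' * G)) \<in> r"
    using r(3) pairs(3) dims(2) unfolding right_mult_decreasing_def by blast
  moreover have "((B', A' + B' * G), (B', A')) \<in> r"
    using r(4) pairs(2) dims(3) unfolding translation_decreasing_def by blast
  ultimately show "((B, A), (B', A')) \<in> r"
    using r(1) by (meson transD)
qed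

theorem theorem2:
  fixes n :: nat
  assumes "n \<ge> 1"
  shows "compatible_preorder n (pair_le n :: ('a :: {ring, monoid_mult} mat \<times> 'a mat) rel) \<and>
         (\<forall>r :: ('a mat \<times> 'a mat) rel. compatible_preorder n r \<longrightarrow> pair_le n \<subseteq> r)"
proof (intro conjI allI impI)
  show "compatible_preorder n (pair_le n :: ('a mat \<times> 'a mat) rel)"
    unfolding compatible_preorder_def
    by (intro conjI preorder_on_pair_le pair_le_left_mult pair_le_right_mult pair_le_translation)
next
  fix r :: "('a mat \<times> 'a mat) rel"
  assume "compatible_preorder n r"
  then show "pair_le n \<subseteq> r" by (rule pair_le_least)
qed

end
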